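(* Let $G=\begin{bmatrix}g_{11}&g_{12}\\ g_{21}&g_{22}\end{bmatrix}$ be a $2\times2$ matrix with complex entries which is generic, i.e. neither of its two columns $\begin{bmatrix}g_{11}\\ g_{21}\end{bmatrix}$, $\begin{bmatrix}g_{12}\\ g_{22}\end{bmatrix}$ vanishes. Put $R_1=(|g_{11}|^2+|g_{21}|^2)^{1/2}$, $R_2=(|g_{12}|^2+|g_{22}|^2)^{1/2}$, $R=R_1R_2$, $\rho=R_1/R_2$. Then: (1) There exists a number $\theta\in[0,\pi/4]$ such that for every $n=1,2,3,\ldots$ $$L_n(z,G)=R^n L_n(\rho z,F_\theta)\qquad\text{for all } z\in\mathbb{C}\setminus\{0\}.$$ (2) The parameter $\theta$ is determined by the matrix $G$ uniquely (that is, there is exactly one $\theta\in[0,\pi/4]$ for which the equality in (1) holds for every $n=1,2,3,\ldots$); in particular $\theta$ does not depend on $n$. (3) $\theta=0$ if and only if the columns of $G$ are orthogonal, that is, $g_{11}\overline{g_{12}}+g_{21}\overline{g_{22}}=0$. Moreover, $\theta=\pi/4$ if and only if the columns of $G$ are proportional, that is, $G$ is of rank one.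
   Context: For a complex $2\times 2$ matrix $G$, $G^*$ is its Hermitian conjugate. For $z\in\mathbb{C}\setminus\{0\}$ and $n=1,2,3,\ldots$ put $$S(z,G)=G\begin{bmatrix}z&0\\0&z^{-1}\end{bmatrix}G^{*},\qquad L_n(z,G)=\operatorname{tr}\big(S(z,G)^n\big).$$ For real $\theta$, $F_\theta=\begin{bmatrix}\cos\theta&\sin\theta\\ \sin\theta&\cos\theta\end{bmatrix}$. *)

theory Defs
  imports "HOL-Analysis.Analysis"
begin

definition hermitian_conj :: "complex^'n^'m \<Rightarrow> complex^'m^'n" where
  "hermitian_conj A = (\<chi> i j. cnj (A $ j $ i))"

text \<open>The overloaded operators \<open>*\<close> and \<open>^\<close> act entrywise on \<open>'a^'n^'n\<close>,
  so powers with respect to the matrix product \<open>**\<close> are defined here.\<close>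

primrec mat_power :: "'a::semiring_1^'n^'n \<Rightarrow> nat \<Rightarrow> 'a^'n^'n" where
  "mat_power A 0 = mat 1"
| "mat_power A (Suc n) = A ** mat_power A n"

definition S_mat :: "complex \<Rightarrow> complex^2^2 \<Rightarrow> complex^2^2" where
  "S_mat z G = G ** vector [vector [z, 0], vector [0, inverse z]] ** hermitian_conj G"

definition L_tr :: "nat \<Rightarrow> complex \<Rightarrow> complex^2^2 \<Rightarrow> complex" where
  "L_tr n z G = trace (mat_power (S_mat z G) n)"

definition F_mat :: "real \<Rightarrow> complex^2^2" where
  "F_mat \<theta> = vector [vector [of_real (cos \<theta>), of_real (sin \<theta>)],
                     vector [of_real (sin \<theta>), of_real (cos \<theta>)]]"

end

theory Submission
  imports Defs
begin

text \<open>By Cayley--Hamilton the traces of the powers of a 2-by-2 matrix are determined by its trace and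
  determinant. The trace of \<open>S(z, G)\<close> is \<open>R (\<rho> z + (\<rho> z)\<inverse>)\<close>, which is already \<open>R\<close> times that of
  \<open>S(\<rho> z, F\<^sub>\<theta>)\<close> for every \<open>\<theta>\<close>, and its determinant is \<open>\<bar>det G\<bar>\<^sup>2 = R\<^sup>2 - \<bar>\<langle>G\<^sub>1, G\<^sub>2\<rangle>\<bar>\<^sup>2\<close> by Lagrange's identity.
  So all the required identities together amount to \<open>R sin 2\<theta> = \<bar>\<langle>G\<^sub>1, G\<^sub>2\<rangle>\<bar>\<close>, where \<open>G\<^sub>1, G\<^sub>2\<close> are
  the columns of \<open>G\<close>.\<close>

lemma trace_2: "trace (A :: 'a::semiring_1^2^2) = A$1$1 + A$2$2"
  by (simp add: trace_def sum_2)

lemma trace_mat_1_2: "trace (mat 1 :: 'a::semiring_1^2^2) = 2"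
  by (simp add: trace_2 mat_def)

text \<open>This is Cayley-Hamilton, \<open>A ** A = trace A * A - det A * 1\<close>, multiplied by
  \<open>mat_power A n\<close> and traced; the entries of that power stay symbolic in the
  expansion.\<close>

lemma trace_mat_power_Suc_Suc:
  fixes A :: "'a::comm_ring_1^2^2"
  shows "trace (mat_power A (Suc (Suc n))) =
    trace A * trace (mat_power A (Suc n)) - det A * trace (mat_power A n)"
  by (simp add: trace_2 det_2 matrix_matrix_mult_def sum_2 algebra_simps)

lemma trace_mat_power_scale:
  fixes A B :: "'a::comm_ring_1^2^2"
  assumes "trace A = r * trace B" "det A = r\<^sup>2 * det B"
  shows "trace (mat_power A n) = r ^ n * trace (mat_power B n)"
proof -
  \<comment> \<open>The recurrence has order two, so the induction carries two consecutive
    exponents.\<close>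
  have "trace (mat_power A n) = r ^ n * trace (mat_power B n) \<and>
    trace (mat_power A (Suc n)) = r ^ Suc n * trace (mat_power B (Suc n))"
  proof (induction n)
    case 0
    then show ?case using assms(1) by (simp add: trace_mat_1_2)
  next
    case (Suc n)
    then show ?case
      unfolding trace_mat_power_Suc_Suc assms
      by (simp add: algebra_simps power2_eq_square)
  qed
  then show ?thesis ..
qed

lemma trace_S_mat:
  "trace (S_mat z G) =
    z * of_real ((cmod (G$1$1))\<^sup>2 + (cmod (G$2$1))\<^sup>2)
      + inverse z * of_real ((cmod (G$1$2))\<^sup>2 + (cmod (G$2$2))\<^sup>2)"
  by (simp add: S_mat_def trace_2 matrix_matrix_mult_def sum_2 hermitian_conj_def
      complex_norm_square algebra_simps del: of_real_power)

text \<open>The diagonal factor has determinant 1, so \<open>z\<close> drops out: the determinant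
  gives one condition on \<open>G\<close>, the same for every \<open>z\<close>.\<close>

lemma det_S_mat:
  assumes "z \<noteq> 0"
  shows "det (S_mat z G) = of_real ((cmod (det G))\<^sup>2)"
proof -
  have "det (hermitian_conj G) = cnj (det G)"
    by (simp add: det_2 hermitian_conj_def)
  moreover have "det (vector [vector [z, 0], vector [0, inverse z]] :: complex^2^2) = 1"
    using assms by (simp add: det_2)
  ultimately show ?thesis
    by (simp add: S_mat_def det_mul complex_norm_square del: of_real_power)
qed

lemma Lagrange_identity_2:
  fixes G :: "complex^2^2"
  shows "(cmod (det G))\<^sup>2 =
    ((cmod (G$1$1))\<^sup>2 + (cmod (G$2$1))\<^sup>2) * ((cmod (G$1$2))\<^sup>2 + (cmod (G$2$2))\<^sup>2)
      - (cmod (G$1$1 * cnj (G$1$2) + G$2$1 * cnj (G$2$2)))\<^sup>2"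
proof -
  \<comment> \<open>Over the complex numbers each squared modulus becomes \<open>w * cnj w\<close>,
    and the claim is a polynomial identity in the entries and their conjugates.\<close>
  have "complex_of_real ((cmod (det G))\<^sup>2) = complex_of_real
    (((cmod (G$1$1))\<^sup>2 + (cmod (G$2$1))\<^sup>2) * ((cmod (G$1$2))\<^sup>2 + (cmod (G$2$2))\<^sup>2)
      - (cmod (G$1$1 * cnj (G$1$2) + G$2$1 * cnj (G$2$2)))\<^sup>2)"
    unfolding of_real_diff of_real_mult of_real_add complex_norm_square
    by (simp add: det_2 algebra_simps)
  then show ?thesis
    by (simp only: of_real_eq_iff)
qed

lemma det_F_mat: "det (F_mat \<theta>) = of_real (cos (2 * \<theta>))"
  by (simp add: F_mat_def det_2 cos_double power2_eq_square)

lemma L_tr_scale_iff: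
  fixes G :: "complex^2^2" and R1 R2 \<theta> :: real
  assumes pos: "R1 > 0" "R2 > 0"
    and R1: "R1\<^sup>2 = (cmod (G $ 1 $ 1))\<^sup>2 + (cmod (G $ 2 $ 1))\<^sup>2"
    and R2: "R2\<^sup>2 = (cmod (G $ 1 $ 2))\<^sup>2 + (cmod (G $ 2 $ 2))\<^sup>2"
  shows "(\<forall>n\<ge>1. \<forall>z. z \<noteq> 0 \<longrightarrow>
      L_tr n z G = of_real (R1 * R2) ^ n * L_tr n (of_real (R1 / R2) * z) (F_mat \<theta>))
    \<longleftrightarrow> (cmod (det G))\<^sup>2 = (R1 * R2 * cos (2 * \<theta>))\<^sup>2"
    (is "?L \<longleftrightarrow> ?R")
proof -
  let ?r = "complex_of_real (R1 * R2)" and ?q = "complex_of_real (R1 / R2)"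
  have tr: "trace (S_mat z G) = ?r * trace (S_mat (?q * z) (F_mat \<theta>))" for z
  proof -
    \<comment> \<open>Both columns of \<open>F_mat \<theta>\<close> are unit vectors, hence no trace
      of \<theta> remains here.\<close>
    have "trace (S_mat (?q * z) (F_mat \<theta>)) = ?q * z + inverse (?q * z)"
      by (simp add: trace_S_mat F_mat_def flip: of_real_power of_real_add)
    moreover have "trace (S_mat z G) = z * of_real (R1\<^sup>2) + inverse z * of_real (R2\<^sup>2)"
      by (simp only: trace_S_mat R1 R2)
    ultimately show ?thesis
      using pos by (simp add: field_simps power2_eq_square)
  qed
  have det1: "det (S_mat z G) = of_real ((cmod (det G))\<^sup>2)" if "z \<noteq> 0" for z
    using that by (rule det_S_mat)
  have det2: "?r\<^sup>2 * det (S_mat (?q * z) (F_mat \<theta>)) = of_real ((R1 * R2 * cos (2 * \<theta>))\<^sup>2)"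
    if "z \<noteq> 0" for z
    using that pos by (simp add: det_S_mat det_F_mat power_mult_distrib)
  show ?thesis
  proof
    assume ?L
    \<comment> \<open>The case n = 1 holds for every \<theta>; n = 2 at z = 1 already isolates the
      determinant, through tr(A^2) = (tr A)^2 - 2 det A.\<close>
    then have "L_tr 2 1 G = ?r ^ 2 * L_tr 2 (?q * 1) (F_mat \<theta>)"
      by simp
    then have "(trace (S_mat 1 G))\<^sup>2 - 2 * det (S_mat 1 G) =
        ?r\<^sup>2 * ((trace (S_mat (?q * 1) (F_mat \<theta>)))\<^sup>2 - 2 * det (S_mat (?q * 1) (F_mat \<theta>)))"
      unfolding L_tr_def numeral_2_eq_2 trace_mat_power_Suc_Suc
      by (simp add: trace_mat_1_2 power2_eq_square algebra_simps)
    then have "det (S_mat 1 G) = ?r\<^sup>2 * det (S_mat (?q * 1) (F_mat \<theta>))"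
      unfolding tr by (simp add: algebra_simps)
    then show ?R
      unfolding det1[OF one_neq_zero] det2[OF one_neq_zero] of_real_eq_iff .
  next
    assume ?R
    then have "det (S_mat z G) = ?r\<^sup>2 * det (S_mat (?q * z) (F_mat \<theta>))" if "z \<noteq> 0" for z
      unfolding det1[OF that] det2[OF that] by simp
    then show ?L
      unfolding L_tr_def by (intro allI impI trace_mat_power_scale tr)
  qed
qed

text \<open>If the first column vanished and the second did not, the determinant would be 0 with no
  such \<open>c\<close>. Otherwise \<open>c\<close> is the quotient of the entries in a row where
  the first column is nonzero.\<close>

lemma columns_proportional_iff_det_eq_0:
  fixes G :: "'a::field^2^2"
  assumes "column 1 G \<noteq> 0"
  shows "(\<exists>c. column 2 G = c *s column 1 G) \<longleftrightarrow> det G = 0"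
proof
  assume "\<exists>c. column 2 G = c *s column 1 G"
  then show "det G = 0"
    by (auto simp: vec_eq_iff column_def det_2)
next
  assume "det G = 0"
  then have d: "G$1$1 * G$2$2 = G$1$2 * G$2$1"
    by (simp add: det_2)
  show "\<exists>c. column 2 G = c *s column 1 G"
  proof (cases "G$1$1 = 0")
    case True
    then have "G$2$1 \<noteq> 0" using assms by (auto simp: vec_eq_iff column_def forall_2)
    with True d have "column 2 G = (G$2$2 / G$2$1) *s column 1 G"
      by (auto simp: vec_eq_iff column_def forall_2)
    then show ?thesis ..
  next
    case False
    with d have "column 2 G = (G$1$2 / G$1$1) *s column 1 G"
      by (auto simp: vec_eq_iff column_def forall_2 field_simps)
    then show ?thesis ..
  qed
qed

text \<open>The rank is at most 2, is not 0 because some row is nonzero, and equals 2 exactly when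
  the matrix is invertible.\<close>

lemma rank_eq_1_iff_det_eq_0:
  fixes G :: "'a::field^2^2"
  assumes "G \<noteq> 0"
  shows "rank G = 1 \<longleftrightarrow> det G = 0"
proof -
  have "rank G \<le> 2"
    unfolding row_rank_def_gen using vec.dim_subset_UNIV[of "rows G"] unfolding vec.dimension_def card_cart_basis
    by simp
  moreover have "rank G \<noteq> 0"
  proof -
    obtain i where "row i G \<noteq> 0"
      using assms by (auto simp: row_def vec_eq_iff)
    then have "\<not> rows G \<subseteq> {0}"
      by (auto simp: rows_def)
    then show ?thesis
      by (simp add: row_rank_def_gen)
  qed
  moreover have "rank G = 2 \<longleftrightarrow> det G \<noteq> 0"
    using vec.dim_eq_full[of "rows G"] unfolding vec.dimension_def card_cart_basis
    by (simp add: row_rank_def_gen invertible_det_nz[symmetric] invertible_left_inverse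
        matrix_left_invertible_span_rows_gen)
  ultimately show ?thesis by auto
qed

theorem theorem1p7:
  fixes G :: "complex^2^2" and R1 R2 R \<rho> :: real
  assumes generic: "column 1 G \<noteq> 0" "column 2 G \<noteq> 0"
    and R1: "R1 = sqrt ((cmod (G $ 1 $ 1))\<^sup>2 + (cmod (G $ 2 $ 1))\<^sup>2)"
    and R2: "R2 = sqrt ((cmod (G $ 1 $ 2))\<^sup>2 + (cmod (G $ 2 $ 2))\<^sup>2)"
    and R: "R = R1 * R2"
    and \<rho>: "\<rho> = R1 / R2"
  shows
    "let E = (\<lambda>\<theta>::real. \<forall>n::nat. n \<ge> 1 \<longrightarrow> (\<forall>z::complex. z \<noteq> 0 \<longrightarrow>
                L_tr n z G = of_real R ^ n * L_tr n (of_real \<rho> * z) (F_mat \<theta>)))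
     in (\<exists>\<theta>\<in>{0..pi/4}. E \<theta>) \<and>
        (\<exists>!\<theta>. \<theta> \<in> {0..pi/4} \<and> E \<theta>) \<and>
        (\<forall>\<theta>\<in>{0..pi/4}. E \<theta> \<longrightarrow>
           (\<theta> = 0 \<longleftrightarrow> G $ 1 $ 1 * cnj (G $ 1 $ 2) + G $ 2 $ 1 * cnj (G $ 2 $ 2) = 0) \<and>
           (\<theta> = pi/4 \<longleftrightarrow> (\<exists>c::complex. column 2 G = c *s column 1 G)) \<and>
           (\<theta> = pi/4 \<longleftrightarrow> rank G = 1))"
proof -
  define ip where "ip = G $ 1 $ 1 * cnj (G $ 1 $ 2) + G $ 2 $ 1 * cnj (G $ 2 $ 2)"
  have "R1 > 0" "R2 > 0"
    using generic
    by (auto simp: R1 R2 vec_eq_iff column_def forall_2 add_nonneg_pos add_pos_nonneg)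
  then have pos: "R > 0" by (simp add: R)
  have sq: "R1\<^sup>2 = (cmod (G $ 1 $ 1))\<^sup>2 + (cmod (G $ 2 $ 1))\<^sup>2"
      "R2\<^sup>2 = (cmod (G $ 1 $ 2))\<^sup>2 + (cmod (G $ 2 $ 2))\<^sup>2"
    by (auto simp: R1 R2)
  have Lag: "(cmod (det G))\<^sup>2 = R\<^sup>2 - (cmod ip)\<^sup>2"
    by (simp add: Lagrange_identity_2 sq R power_mult_distrib ip_def)
  define E where "E = (\<lambda>\<theta>::real. \<forall>n::nat. n \<ge> 1 \<longrightarrow> (\<forall>z::complex. z \<noteq> 0 \<longrightarrow>
                L_tr n z G = of_real R ^ n * L_tr n (of_real \<rho> * z) (F_mat \<theta>)))"
  \<comment> \<open>Lagrange's identity turns the cosine condition into one between squares of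
    sines; since \<open>2 * \<theta>\<close> lies in [0, pi/2], both sides are nonnegative and the
    squares can be removed.\<close>
  have E_iff: "E \<theta> \<longleftrightarrow> sin (2 * \<theta>) = cmod ip / R" if "\<theta> \<in> {0..pi/4}" for \<theta>
  proof -
    have "0 \<le> sin (2 * \<theta>)" using that by (intro sin_ge_zero) auto
    have "E \<theta> \<longleftrightarrow> (cmod (det G))\<^sup>2 = (R * cos (2 * \<theta>))\<^sup>2"
      unfolding E_def R \<rho> using L_tr_scale_iff[OF \<open>R1 > 0\<close> \<open>R2 > 0\<close> sq] .
    also have "\<dots> \<longleftrightarrow> (cmod ip)\<^sup>2 = (R * sin (2 * \<theta>))\<^sup>2"
      unfolding Lag power_mult_distrib cos_squared_eq by (auto simp: algebra_simps)
    also have "\<dots> \<longleftrightarrow> cmod ip = R * sin (2 * \<theta>)"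
      using \<open>0 \<le> sin (2 * \<theta>)\<close> pos by simp
    finally show ?thesis using pos by (auto simp: field_simps)
  qed
  \<comment> \<open>Cauchy-Schwarz for the columns, which puts \<open>cmod ip / R\<close> in the
    domain of \<open>arcsin\<close>.\<close>
  have "(cmod ip)\<^sup>2 \<le> R\<^sup>2"
    using Lag zero_le_power2[of "cmod (det G)"] by linarith
  then have "cmod ip \<le> R"
    using pos by (rule power2_le_imp_le[OF _ less_imp_le])
  then have le1: "0 \<le> cmod ip / R" "cmod ip / R \<le> 1"
    using pos by (simp_all add: field_simps)
  define \<theta>0 where "\<theta>0 = arcsin (cmod ip / R) / 2"
  have \<theta>0: "\<theta>0 \<in> {0..pi/4}"
    using le1 arcsin_bounded[of "cmod ip / R"] arcsin_le_arcsin[of 0 "cmod ip / R"]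
    by (auto simp: \<theta>0_def)
  have "E \<theta>0"
    unfolding E_iff[OF \<theta>0] using le1 by (simp add: \<theta>0_def)
  \<comment> \<open>Sine is injective on [0, pi/2]. This yields uniqueness and, with \<theta>' = 0
    or pi/4, both extreme cases.\<close>
  have eq_iff: "\<theta> = \<theta>' \<longleftrightarrow> sin (2 * \<theta>) = sin (2 * \<theta>')"
    if "\<theta> \<in> {0..pi/4}" "\<theta>' \<in> {0..pi/4}" for \<theta> \<theta>'
  proof
    assume "sin (2 * \<theta>) = sin (2 * \<theta>')"
    then have "2 * \<theta> = 2 * \<theta>'"
      by (rule sin_inj_pi[rotated 4]) (use that pi_gt_zero in auto)
    then show "\<theta> = \<theta>'" by simp
  qed simp
  have uniq: "\<exists>!\<theta>. \<theta> \<in> {0..pi/4} \<and> E \<theta>"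
  proof (intro ex1I[of _ \<theta>0] conjI \<theta>0 \<open>E \<theta>0\<close>)
    fix \<theta> assume "\<theta> \<in> {0..pi/4} \<and> E \<theta>"
    then show "\<theta> = \<theta>0"
      using eq_iff[of \<theta> \<theta>0] E_iff[of \<theta>] E_iff[OF \<theta>0] \<theta>0 \<open>E \<theta>0\<close> by metis
  qed
  have special: "(\<theta> = 0 \<longleftrightarrow> ip = 0) \<and>
      (\<theta> = pi/4 \<longleftrightarrow> (\<exists>c. column 2 G = c *s column 1 G)) \<and>
      (\<theta> = pi/4 \<longleftrightarrow> rank G = 1)" if "\<theta> \<in> {0..pi/4}" "E \<theta>" for \<theta>
  proof -
    have s: "sin (2 * \<theta>) = cmod ip / R" using that E_iff by blast
    have "\<theta> = 0 \<longleftrightarrow> ip = 0"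
      using eq_iff[OF that(1), of 0] s pos by simp
    moreover have "\<theta> = pi/4 \<longleftrightarrow> cmod ip = R"
      using eq_iff[OF that(1), of "pi/4"] s pos by auto
    \<comment> \<open>The equality case of Cauchy-Schwarz, where sin(2 \<theta>) = 1.\<close>
    moreover have "cmod ip = R \<longleftrightarrow> det G = 0"
      using Lag pos power2_eq_iff_nonneg[of "cmod ip" R] by auto
    moreover have "G \<noteq> 0" using generic(1) by (auto simp: column_def vec_eq_iff)
    ultimately show ?thesis
      using columns_proportional_iff_det_eq_0[OF generic(1)] rank_eq_1_iff_det_eq_0[of G] by simp
  qed
  show ?thesis
    unfolding Let_def E_def[symmetric] ip_def[symmetric]
    by (intro conjI bexI[of _ \<theta>0] ballI impI \<theta>0 \<open>E \<theta>0\<close> uniq special)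
qed

end
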